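(* Let $f(a_1,\dots,a_m,k)$ be a hypergeometric term in the variables $a_1,\dots,a_m,k$. The following are equivalent: (1) $f$ is a WZ-seed in the variables $a_1,\dots,a_m$, i.e. for all integers $A_1,\dots,A_m,K$, the function $F(n,k)=f(a_1+A_1n,\dots,a_m+A_mn,k+Kn)$ has a hypergeometric WZ-mate $G(n,k)$; (2) for each $i=1,\dots,m$ there exists a rational function $r_i$ (in $a_1,\dots,a_m,k$) such that $\Delta_{a_i}(f)=\Delta_k(r_i f)$.
   Context: A hypergeometric term in variables $x_1,\dots,x_r$ is a function $f$ such that for each $j$ the ratio $f(\dots,x_j+1,\dots)/f(\dots,x_j,\dots)$ is a rational function of $x_1,\dots,x_r$. Given $F(n,k)$, a hypergeometric WZ-mate is a function $G(n,k)$ with $G/F$ a rational function of $n,k$ (so $G$ is also hypergeometric) such that $F(n+1,k)-F(n,k)=G(n,k+1)-G(n,k)$. For a variable $x$, $\Delta_x$ is the forward difference in $x$: $\Delta_x h(x)=h(x+1)-h(x)$ (other variables held fixed). *)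

theory Defs
  imports Complex_Main
begin

text \<open>
  A point of the space with variables indexed by \<^typ>\<open>'v\<close> is a function \<^typ>\<open>'v \<Rightarrow> complex\<close>.
  Since the complex numbers are an infinite field, polynomials over them may be identified with
  polynomial functions.
\<close>

inductive polynomial_fun :: "(('v \<Rightarrow> complex) \<Rightarrow> complex) \<Rightarrow> bool" where
  const: "polynomial_fun (\<lambda>x. c)"
| var: "polynomial_fun (\<lambda>x. x v)"
| add: "polynomial_fun p \<Longrightarrow> polynomial_fun q \<Longrightarrow> polynomial_fun (\<lambda>x. p x + q x)"
| mult: "polynomial_fun p \<Longrightarrow> polynomial_fun q \<Longrightarrow> polynomial_fun (\<lambda>x. p x * q x)"

text \<open>
  The value of a rational function on the zero set of its denominator is the irrelevant value
  \<open>p x / 0 = 0\<close>: rational functions only occur inside identities that are required to hold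
  generically.
\<close>

definition rational_fun :: "(('v \<Rightarrow> complex) \<Rightarrow> complex) \<Rightarrow> bool" where
  "rational_fun r \<longleftrightarrow>
     (\<exists>p q. polynomial_fun p \<and> polynomial_fun q \<and> (\<exists>x. q x \<noteq> 0) \<and> r = (\<lambda>x. p x / q x))"

text \<open>
  Terms built from Gamma functions have poles, so identities between them are understood off a
  proper algebraic subset, that is, off the zero set of some nonzero polynomial.
\<close>

definition generically :: "(('v \<Rightarrow> complex) \<Rightarrow> bool) \<Rightarrow> bool" where
  "generically P \<longleftrightarrow>
     (\<exists>h. polynomial_fun h \<and> (\<exists>x. h x \<noteq> 0) \<and> (\<forall>x. h x \<noteq> 0 \<longrightarrow> P x))"

definition shift :: "'v \<Rightarrow> ('v \<Rightarrow> complex) \<Rightarrow> ('v \<Rightarrow> complex)" where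
  "shift v x = x(v := x v + 1)"

definition fwd_diff :: "'v \<Rightarrow> (('v \<Rightarrow> complex) \<Rightarrow> complex) \<Rightarrow> ('v \<Rightarrow> complex) \<Rightarrow> complex" where
  "fwd_diff v h x = h (shift v x) - h x"

text \<open>
  \<open>g / f\<close> is a rational function. The quotient is cleared because \<open>f\<close> may vanish on sets that no
  proper algebraic subset contains, such as the zeros of the reciprocal Gamma function.
\<close>

definition rational_ratio ::
    "(('v \<Rightarrow> complex) \<Rightarrow> complex) \<Rightarrow> (('v \<Rightarrow> complex) \<Rightarrow> complex) \<Rightarrow> bool" where
  "rational_ratio g f \<longleftrightarrow> (\<exists>R. rational_fun R \<and> generically (\<lambda>x. g x = R x * f x))"

definition hypergeometric_term :: "(('v \<Rightarrow> complex) \<Rightarrow> complex) \<Rightarrow> bool" where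
  "hypergeometric_term f \<longleftrightarrow> (\<forall>v. rational_ratio (\<lambda>x. f (shift v x)) f)"

text \<open>
  The variables \<open>a\<^sub>i, k\<close> of a seed, and the variables \<open>a\<^sub>i, n, k\<close> of the associated WZ-pairs,
  where \<open>i\<close> ranges over \<^typ>\<open>'m\<close>.
\<close>

datatype 'm seed_var = Var_a 'm | Var_k

datatype 'm wz_var = WZ_a 'm | WZ_n | WZ_k

text \<open>
  The \<open>a\<^sub>i\<close> remain present in \<open>F\<close> as indeterminate parameters, so a rational function of \<open>n, k\<close>
  has coefficients that are rational in the \<open>a\<^sub>i\<close>; that is, it is a rational function of
  \<open>a\<^sub>1, \<dots>, a\<^sub>m, n, k\<close>.
\<close>

definition wz_mate ::
    "(('m wz_var \<Rightarrow> complex) \<Rightarrow> complex) \<Rightarrow> (('m wz_var \<Rightarrow> complex) \<Rightarrow> complex) \<Rightarrow> bool" where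
  "wz_mate F G \<longleftrightarrow>
     rational_ratio G F \<and> generically (\<lambda>x. fwd_diff WZ_n F x = fwd_diff WZ_k G x)"

text \<open>\<open>F(n, k) = f(a\<^sub>1 + A\<^sub>1 n, \<dots>, a\<^sub>m + A\<^sub>m n, k + K n)\<close>\<close>

definition seed_line ::
    "(('m seed_var \<Rightarrow> complex) \<Rightarrow> complex) \<Rightarrow> ('m \<Rightarrow> int) \<Rightarrow> int \<Rightarrow> ('m wz_var \<Rightarrow> complex) \<Rightarrow> complex" where
  "seed_line f A K x =
     f (\<lambda>v. case v of Var_a i \<Rightarrow> x (WZ_a i) + of_int (A i) * x WZ_n
                    | Var_k \<Rightarrow> x WZ_k + of_int K * x WZ_n)"

definition wz_seed :: "(('m seed_var \<Rightarrow> complex) \<Rightarrow> complex) \<Rightarrow> bool" where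
  "wz_seed f \<longleftrightarrow> (\<forall>A K. \<exists>G. wz_mate (seed_line f A K) G)"

end

theory Submission
  imports Defs "HOL-Computational_Algebra.Polynomial"
begin

text \<open>
  Call a vector \<open>w\<close> good if \<open>f(x + w) / f(x)\<close> is rational and \<open>f(x + w) - f(x)\<close> is the
  \<open>k\<close>-difference of a rational multiple of \<open>f\<close>. Since
  \<open>f(x + v + w) - f(x) = (f(x + w + v) - f(x + w)) + (f(x + w) - f(x))\<close>, the good vectors form an
  additive group. Condition (2) says that the unit vectors of the \<open>a\<^sub>i\<close> are good, and that of
  \<open>k\<close> always is, so all integer vectors \<open>(A, K)\<close> are good; substituting
  \<open>(a + A n, k + K n)\<close> for \<open>x\<close> turns this into a WZ-mate. Conversely, a WZ-mate for the direction of
  \<open>a\<^sub>i\<close>, restricted to a generic constant value of \<open>n\<close>, gives \<open>r\<^sub>i\<close>.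
\<close>

section \<open>Generic identities\<close>

definition translate :: "('v \<Rightarrow> complex) \<Rightarrow> ('v \<Rightarrow> complex) \<Rightarrow> 'v \<Rightarrow> complex" where
  "translate w x = (\<lambda>u. x u + w u)"

definition unit_vec :: "'v \<Rightarrow> 'v \<Rightarrow> complex" where
  "unit_vec v = (\<lambda>u. if u = v then 1 else 0)"

definition polynomial_map :: "(('u \<Rightarrow> complex) \<Rightarrow> 'v \<Rightarrow> complex) \<Rightarrow> bool" where
  "polynomial_map T \<longleftrightarrow> (\<forall>v. polynomial_fun (\<lambda>x. T x v))"

lemma shift_eq_translate: "shift v = translate (unit_vec v)"
  by (auto simp: shift_def translate_def unit_vec_def fun_eq_iff)

lemma translate_translate: "translate v (translate w x) = translate (\<lambda>u. v u + w u) x"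
  by (auto simp: translate_def algebra_simps)

lemma shift_translate: "shift v (translate w x) = translate w (shift v x)"
  by (simp add: shift_eq_translate translate_translate add.commute)

lemma polynomial_map_translate: "polynomial_map (translate w)"
  unfolding polynomial_map_def translate_def
  by (auto intro: polynomial_fun.intros)

lemma surj_translate: "surj (translate w)"
proof (rule surjI)
  show "translate w (translate (\<lambda>u. - w u) x) = x" for x
    by (simp add: translate_def)
qed

lemma polynomial_fun_comp:
  assumes "polynomial_fun p" "polynomial_map T"
  shows "polynomial_fun (\<lambda>x. p (T x))"
  using assms(1)
  by induction (use assms(2) in \<open>auto intro: polynomial_fun.intros simp: polynomial_map_def\<close>)

section \<open>Restriction to lines and products of nonzero polynomial functions\<close>

lemma polynomial_fun_on_line:
  assumes "polynomial_fun p"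
  shows "\<exists>P. \<forall>t. p (\<lambda>v. x v + t * d v) = poly P t"
  using assms
proof induction
  case (const c)
  show ?case by (rule exI[of _ "[:c:]"]) simp
next
  case (var v)
  show ?case by (rule exI[of _ "[:x v, d v:]"]) simp
next
  case (add p q)
  then show ?case by (metis poly_add)
next
  case (mult p q)
  then show ?case by (metis poly_mult)
qed

text \<open>The line joining a nonzero of \<open>p\<close> to a nonzero of \<open>q\<close> reduces
  the claim to one variable: both restrictions are nonzero univariate polynomials, hence so is their
  product, and it has a nonzero value on that line.\<close>

lemma polynomial_fun_mult_nonzero:
  assumes "polynomial_fun p" "polynomial_fun q" "\<exists>x. p x \<noteq> 0" "\<exists>x. q x \<noteq> 0"
  shows "\<exists>x. p x * q x \<noteq> 0"
proof -
  obtain x y where xy: "p x \<noteq> 0" "q y \<noteq> 0" using assms(3,4) by blast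
  obtain P where P: "\<And>t. p (\<lambda>v. x v + t * (y v - x v)) = poly P t"
    using polynomial_fun_on_line[OF assms(1), of x "\<lambda>v. y v - x v"] by metis
  obtain Q where Q: "\<And>t. q (\<lambda>v. x v + t * (y v - x v)) = poly Q t"
    using polynomial_fun_on_line[OF assms(2), of x "\<lambda>v. y v - x v"] by metis
  have "poly P 0 \<noteq> 0" "poly Q 1 \<noteq> 0"
    using P[of 0] Q[of 1] xy by simp_all
  then have "P * Q \<noteq> 0" by auto
  then obtain t where "poly (P * Q) t \<noteq> 0"
    using poly_all_0_iff_0 by blast
  then show ?thesis by (metis P Q poly_mult)
qed

text \<open>The product of the two witnessing polynomials serves both properties; it is nonzero
  because polynomial functions have no zero divisors.\<close>

lemma generically_conj:
  assumes "generically P" "generically Q"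
  shows "generically (\<lambda>x. P x \<and> Q x)"
proof -
  obtain g h where "polynomial_fun g" "\<exists>x. g x \<noteq> 0" "\<And>x. g x \<noteq> 0 \<Longrightarrow> P x"
    and "polynomial_fun h" "\<exists>x. h x \<noteq> 0" "\<And>x. h x \<noteq> 0 \<Longrightarrow> Q x"
    using assms unfolding generically_def by metis
  then show ?thesis
    unfolding generically_def
    using polynomial_fun_mult_nonzero[of g h]
    by (intro exI[of _ "\<lambda>x. g x * h x"]) (simp add: polynomial_fun.mult)
qed

lemma generically_mono:
  assumes "generically P" "\<And>x. P x \<Longrightarrow> Q x"
  shows "generically Q"
  using assms unfolding generically_def by metis

lemma generically_mono2:
  assumes "generically P" "generically Q" "\<And>x. P x \<Longrightarrow> Q x \<Longrightarrow> S x"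
  shows "generically S"
  using generically_mono[OF generically_conj[OF assms(1,2)]] assms(3) by blast

lemma generically_nonzero:
  assumes "polynomial_fun q" "\<exists>x. q x \<noteq> 0"
  shows "generically (\<lambda>x. q x \<noteq> 0)"
  using assms unfolding generically_def by blast

lemma generically_trivial: "(\<And>x. P x) \<Longrightarrow> generically P"
  unfolding generically_def by (rule exI[of _ "\<lambda>_. 1"]) (auto intro: polynomial_fun.const)

lemma generically_imp_ex:
  assumes "generically P"
  shows "\<exists>x. P x"
  using assms unfolding generically_def by blast

text \<open>Surjectivity keeps the pulled-back witness nonzero: a point where \<open>h\<close> does
  not vanish has a preimage under \<open>T\<close>.\<close>

lemma generically_comp:
  assumes "generically P" "polynomial_map T" "surj T"
  shows "generically (\<lambda>x. P (T x))"
proof -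
  obtain h z where h: "polynomial_fun h" "h z \<noteq> 0" "\<And>x. h x \<noteq> 0 \<Longrightarrow> P x"
    using assms(1) unfolding generically_def by blast
  obtain y where "z = T y" using assms(3) by blast
  with h polynomial_fun_comp[OF h(1) assms(2)] show ?thesis
    unfolding generically_def by blast
qed

lemma generically_translate:
  "generically P \<Longrightarrow> generically (\<lambda>x. P (translate w x))"
  by (rule generically_comp[OF _ polynomial_map_translate surj_translate])

section \<open>Rational ratios\<close>

text \<open>The cleared form \<open>q * g = p * f\<close> turns later calculations with ratios into
  polynomial identities, with no division by a possibly vanishing value.\<close>

lemma rational_ratioI:
  assumes "polynomial_fun p" "polynomial_fun q" "\<exists>x. q x \<noteq> 0"
    and "generically (\<lambda>x. q x * g x = p x * f x)"
  shows "rational_ratio g f"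
  unfolding rational_ratio_def
proof (intro exI conjI)
  show "rational_fun (\<lambda>x. p x / q x)"
    unfolding rational_fun_def using assms(1-3) by blast
  show "generically (\<lambda>x. g x = p x / q x * f x)"
    by (rule generically_mono2[OF assms(4) generically_nonzero[OF assms(2,3)]])
       (simp add: field_simps)
qed

lemma rational_ratioE:
  assumes "rational_ratio g f"
  obtains p q where "polynomial_fun p" "polynomial_fun q" "\<exists>x. q x \<noteq> 0"
    "generically (\<lambda>x. q x * g x = p x * f x)"
proof -
  obtain p q where pq: "polynomial_fun p" "polynomial_fun q" "\<exists>x. q x \<noteq> 0"
      and g: "generically (\<lambda>x. g x = p x / q x * f x)"
    using assms unfolding rational_ratio_def rational_fun_def by blast
  have "generically (\<lambda>x. q x * g x = p x * f x)"
    by (rule generically_mono2[OF g generically_nonzero[OF pq(2,3)]]) (simp add: field_simps)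
  with pq show thesis by (rule that)
qed

lemma rational_ratio_generically_zero:
  "generically (\<lambda>x. g x = 0) \<Longrightarrow> rational_ratio g f"
  by (rule rational_ratioI[of "\<lambda>_. 0" "\<lambda>_. 1"]) (auto intro: polynomial_fun.const)

lemma rational_ratio_refl: "rational_ratio f f"
  by (rule rational_ratioI[of "\<lambda>_. 1" "\<lambda>_. 1"])
     (auto intro: polynomial_fun.const generically_trivial)

lemma rational_ratio_uminus:
  assumes "rational_ratio g f"
  shows "rational_ratio (\<lambda>x. - g x) f"
proof -
  obtain p q where pq: "polynomial_fun p" "polynomial_fun q" "\<exists>x. q x \<noteq> 0"
      "generically (\<lambda>x. q x * g x = p x * f x)"
    using assms by (rule rational_ratioE)
  have "polynomial_fun (\<lambda>x. - 1 * p x)"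
    by (rule polynomial_fun.mult[OF polynomial_fun.const pq(1)])
  then show ?thesis
    by (rule rational_ratioI[OF _ pq(2,3)]) (rule generically_mono[OF pq(4)], simp)
qed

lemma rational_ratio_add:
  assumes "rational_ratio g f" "rational_ratio h f"
  shows "rational_ratio (\<lambda>x. g x + h x) f"
proof -
  obtain p q where pq: "polynomial_fun p" "polynomial_fun q" "\<exists>x. q x \<noteq> 0"
      "generically (\<lambda>x. q x * g x = p x * f x)"
    using assms(1) by (rule rational_ratioE)
  obtain p' q' where pq': "polynomial_fun p'" "polynomial_fun q'" "\<exists>x. q' x \<noteq> 0"
      "generically (\<lambda>x. q' x * h x = p' x * f x)"
    using assms(2) by (rule rational_ratioE)
  have "\<exists>x. q x * q' x \<noteq> 0"
    by (rule polynomial_fun_mult_nonzero[OF pq(2) pq'(2) pq(3) pq'(3)])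
  moreover have "generically (\<lambda>x. q x * q' x * (g x + h x) = (q' x * p x + q x * p' x) * f x)"
  proof (rule generically_mono2[OF pq(4) pq'(4)])
    fix x
    assume "q x * g x = p x * f x" "q' x * h x = p' x * f x"
    then show "q x * q' x * (g x + h x) = (q' x * p x + q x * p' x) * f x" by algebra
  qed
  ultimately show ?thesis
    by (rule rational_ratioI[OF polynomial_fun.add[OF polynomial_fun.mult[OF pq'(2) pq(1)]
          polynomial_fun.mult[OF pq(2) pq'(1)]] polynomial_fun.mult[OF pq(2) pq'(2)]])
qed

lemma rational_ratio_trans:
  assumes "rational_ratio h g" "rational_ratio g f"
  shows "rational_ratio h f"
proof -
  obtain p q where pq: "polynomial_fun p" "polynomial_fun q" "\<exists>x. q x \<noteq> 0"
      "generically (\<lambda>x. q x * h x = p x * g x)"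
    using assms(1) by (rule rational_ratioE)
  obtain p' q' where pq': "polynomial_fun p'" "polynomial_fun q'" "\<exists>x. q' x \<noteq> 0"
      "generically (\<lambda>x. q' x * g x = p' x * f x)"
    using assms(2) by (rule rational_ratioE)
  have "\<exists>x. q x * q' x \<noteq> 0"
    by (rule polynomial_fun_mult_nonzero[OF pq(2) pq'(2) pq(3) pq'(3)])
  moreover have "generically (\<lambda>x. q x * q' x * h x = (p x * p' x) * f x)"
  proof (rule generically_mono2[OF pq(4) pq'(4)])
    fix x
    assume "q x * h x = p x * g x" "q' x * g x = p' x * f x"
    then show "q x * q' x * h x = (p x * p' x) * f x" by algebra
  qed
  ultimately show ?thesis
    by (rule rational_ratioI[OF polynomial_fun.mult[OF pq(1) pq'(1)]
          polynomial_fun.mult[OF pq(2) pq'(2)]])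
qed

lemma rational_ratio_comp:
  assumes "rational_ratio g f" "polynomial_map T" "surj T"
  shows "rational_ratio (\<lambda>x. g (T x)) (\<lambda>x. f (T x))"
proof -
  obtain p q where pq: "polynomial_fun p" "polynomial_fun q" "\<exists>x. q x \<noteq> 0"
      "generically (\<lambda>x. q x * g x = p x * f x)"
    using assms(1) by (rule rational_ratioE)
  have "\<exists>x. q (T x) \<noteq> 0" using pq(3) assms(3) by (metis surj_def)
  then show ?thesis
    by (rule rational_ratioI[OF polynomial_fun_comp[OF pq(1) assms(2)]
          polynomial_fun_comp[OF pq(2) assms(2)]])
       (rule generically_comp[OF pq(4) assms(2,3)])
qed

section \<open>Ratios under translation\<close>

lemma rational_ratio_translate:
  "rational_ratio g f \<Longrightarrow> rational_ratio (\<lambda>x. g (translate w x)) (\<lambda>x. f (translate w x))"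
  by (rule rational_ratio_comp[OF _ polynomial_map_translate surj_translate])

text \<open>Translating \<open>q(x) f(x + w) = p(x) f(x)\<close> by \<open>- w\<close> and reading
  it backwards makes \<open>p\<close> the new denominator. This fails when \<open>p\<close> is the
  zero function, but then \<open>f\<close> vanishes generically.\<close>

lemma rational_ratio_translate_uminus:
  assumes "rational_ratio (\<lambda>x. f (translate w x)) f"
  shows "rational_ratio (\<lambda>x. f (translate (\<lambda>u. - w u) x)) f"
proof -
  let ?w = "\<lambda>u. - w u"
  have inv: "translate w (translate ?w x) = x" for x
    by (simp add: translate_def)
  obtain p q where pq: "polynomial_fun p" "polynomial_fun q" "\<exists>x. q x \<noteq> 0"
      "generically (\<lambda>x. q x * f (translate w x) = p x * f x)"
    using assms by (rule rational_ratioE)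
  show ?thesis
  proof (cases "\<exists>y. p y \<noteq> 0")
    case True
    then obtain y where y: "p y \<noteq> 0" by blast
    have "p (translate ?w (translate w y)) \<noteq> 0"
      using y by (simp add: translate_def)
    then have "\<exists>x. p (translate ?w x) \<noteq> 0" by blast
    moreover have "generically (\<lambda>x. p (translate ?w x) * f (translate ?w x)
        = q (translate ?w x) * f x)"
      by (rule generically_mono[OF generically_translate[OF pq(4), of ?w]]) (simp add: inv)
    ultimately show ?thesis
      by (rule rational_ratioI[OF polynomial_fun_comp[OF pq(2) polynomial_map_translate]
            polynomial_fun_comp[OF pq(1) polynomial_map_translate]])
  next
    case False
    have "generically (\<lambda>x. f (translate w x) = 0)"
      by (rule generically_mono2[OF pq(4) generically_nonzero[OF pq(2,3)]]) (use False in simp)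
    \<comment> \<open>The first translation by \<open>- w\<close> cancels \<open>w\<close>; the
      second carries the vanishing over to \<open>f(x - w)\<close>.\<close>
    then have "generically (\<lambda>x. f (translate w (translate ?w (translate ?w x))) = 0)"
      by (rule generically_translate[OF generically_translate])
    then show ?thesis
      by (intro rational_ratio_generically_zero) (simp add: inv)
  qed
qed

section \<open>Telescoping directions\<close>

text \<open>A function \<open>G\<close> with rational ratio equals \<open>r * f\<close> only
  generically, while the difference evaluates it at two points; translating the generic identity
  secures the second one. Afterwards \<open>G\<close> can replace the explicit multiplier
  \<open>r\<close>.\<close>

lemma rational_multiple_iff_rational_ratio:
  "(\<exists>r. rational_fun r \<and> generically (\<lambda>x. L x = fwd_diff v (\<lambda>y. r y * f y) x)) \<longleftrightarrow>
   (\<exists>G. rational_ratio G f \<and> generically (\<lambda>x. L x = fwd_diff v G x))" (is "?l \<longleftrightarrow> ?r")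
proof
  assume ?l
  then obtain r where "rational_fun r" "generically (\<lambda>x. L x = fwd_diff v (\<lambda>y. r y * f y) x)"
    by blast
  then show ?r
    by (intro exI[of _ "\<lambda>y. r y * f y"]) (auto simp: rational_ratio_def intro: generically_trivial)
next
  assume ?r
  then obtain G r where r: "rational_fun r" and G: "generically (\<lambda>x. G x = r x * f x)"
    and L: "generically (\<lambda>x. L x = fwd_diff v G x)"
    unfolding rational_ratio_def by blast
  have "generically (\<lambda>x. G (shift v x) = r (shift v x) * f (shift v x))"
    unfolding shift_eq_translate by (rule generically_translate[OF G])
  then have "generically (\<lambda>x. fwd_diff v G x = fwd_diff v (\<lambda>y. r y * f y) x)"
    by (rule generically_mono2[OF G]) (simp add: fwd_diff_def)
  then have "generically (\<lambda>x. L x = fwd_diff v (\<lambda>y. r y * f y) x)"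
    by (rule generically_mono2[OF L]) simp
  with r show ?l by blast
qed

text \<open>The good vectors of the overview, with certificate \<open>G\<close>. The ratio clause is
  carried along because a translate of \<open>G\<close> is a priori a rational multiple of the
  translate of \<open>f\<close>, and has to become one of \<open>f\<close> itself.\<close>

definition telescoping ::
    "'v \<Rightarrow> (('v \<Rightarrow> complex) \<Rightarrow> complex) \<Rightarrow> ('v \<Rightarrow> complex) \<Rightarrow> bool" where
  "telescoping k f w \<longleftrightarrow>
     rational_ratio (\<lambda>x. f (translate w x)) f \<and>
     (\<exists>G. rational_ratio G f \<and> generically (\<lambda>x. f (translate w x) - f x = fwd_diff k G x))"

lemma telescoping_zero: "telescoping k f (\<lambda>_. 0)"
  unfolding telescoping_def
  by (auto simp: translate_def fwd_diff_def
      intro!: rational_ratio_refl exI[of _ "\<lambda>_. 0"] rational_ratio_generically_zero generically_trivial)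

text \<open>The certificate is \<open>G(x + w) + H(x)\<close>: the first certificate is evaluated at
  the point reached by \<open>w\<close>, and translation commutes with the shift in
  \<open>k\<close>.\<close>

lemma telescoping_add:
  assumes v: "telescoping k f v" and w: "telescoping k f w"
  shows "telescoping k f (\<lambda>u. v u + w u)"
proof -
  obtain G where G: "rational_ratio G f" "generically (\<lambda>x. f (translate v x) - f x = fwd_diff k G x)"
    using v unfolding telescoping_def by blast
  obtain H where H: "rational_ratio H f" "generically (\<lambda>x. f (translate w x) - f x = fwd_diff k H x)"
    using w unfolding telescoping_def by blast
  have fv: "rational_ratio (\<lambda>x. f (translate v x)) f" and fw: "rational_ratio (\<lambda>x. f (translate w x)) f"
    using v w unfolding telescoping_def by blast+
  have "rational_ratio (\<lambda>x. f (translate (\<lambda>u. v u + w u) x)) f"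
    using rational_ratio_trans[OF rational_ratio_translate[OF fv, of w] fw]
    by (simp add: translate_translate)
  moreover have "rational_ratio (\<lambda>x. G (translate w x) + H x) f"
    by (intro rational_ratio_add H(1) rational_ratio_trans[OF rational_ratio_translate[OF G(1)] fw])
  moreover have "generically (\<lambda>x. f (translate (\<lambda>u. v u + w u) x) - f x
      = fwd_diff k (\<lambda>x. G (translate w x) + H x) x)"
    by (rule generically_mono2[OF generically_translate[OF G(2), of w] H(2)])
       (simp add: translate_translate fwd_diff_def shift_translate, algebra)
  ultimately show ?thesis unfolding telescoping_def by blast
qed

text \<open>Evaluating the difference along \<open>w\<close> at \<open>x - w\<close> and changing
  sign gives the difference along \<open>- w\<close>, with certificate
  \<open>- G(x - w)\<close>.\<close>

lemma telescoping_uminus: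
  assumes "telescoping k f w"
  shows "telescoping k f (\<lambda>u. - w u)"
proof -
  let ?w = "\<lambda>u. - w u"
  obtain G where G: "rational_ratio G f" "generically (\<lambda>x. f (translate w x) - f x = fwd_diff k G x)"
    and fw: "rational_ratio (\<lambda>x. f (translate w x)) f"
    using assms unfolding telescoping_def by blast
  have inv: "translate w (translate ?w x) = x" for x
    by (simp add: translate_def)
  have fw': "rational_ratio (\<lambda>x. f (translate ?w x)) f"
    by (rule rational_ratio_translate_uminus[OF fw])
  have "rational_ratio (\<lambda>x. - G (translate ?w x)) f"
    by (intro rational_ratio_uminus rational_ratio_trans[OF rational_ratio_translate[OF G(1)] fw'])
  moreover have "generically (\<lambda>x. f (translate ?w x) - f x = fwd_diff k (\<lambda>x. - G (translate ?w x)) x)"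
    by (rule generically_mono[OF generically_translate[OF G(2), of ?w]])
       (simp add: inv fwd_diff_def shift_translate, algebra)
  ultimately show ?thesis using fw' unfolding telescoping_def by blast
qed

lemma telescoping_int_mult:
  assumes "telescoping k f w"
  shows "telescoping k f (\<lambda>u. of_int c * w u)"
proof -
  have nat: "telescoping k f (\<lambda>u. of_nat n * w u)" for n
  proof (induction n)
    case 0
    show ?case using telescoping_zero by simp
  next
    case (Suc n)
    show ?case using telescoping_add[OF assms Suc] by (simp add: algebra_simps)
  qed
  show ?thesis
  proof (cases c)
    case (nonneg n)
    then show ?thesis using nat[of n] by simp
  next
    \<comment> \<open>Here \<open>c\<close> is \<open>- int (Suc n)\<close>, so the multiple to
      negate is \<open>Suc n\<close>.\<close>
    case (neg n)
    then have "(\<lambda>u. of_int c * w u) = (\<lambda>u. - (of_nat (Suc n) * w u))"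
      by (simp only: of_int_minus of_int_of_nat_eq mult_minus_left)
    then show ?thesis using telescoping_uminus[OF nat[of "Suc n"]] by metis
  qed
qed

lemma telescoping_sum:
  assumes "finite I" "\<And>i. i \<in> I \<Longrightarrow> telescoping k f (w i)"
  shows "telescoping k f (\<lambda>u. \<Sum>i\<in>I. w i u)"
  using assms
  by (induction I rule: finite_induct) (auto intro: telescoping_zero telescoping_add)

text \<open>The certificate is \<open>f\<close> itself, that is, the multiplier 1.\<close>

lemma telescoping_self:
  assumes "hypergeometric_term f"
  shows "telescoping k f (unit_vec k)"
proof -
  have "rational_ratio (\<lambda>x. f (translate (unit_vec k) x)) f"
    using assms by (simp add: hypergeometric_term_def shift_eq_translate)
  moreover have "generically (\<lambda>x. f (translate (unit_vec k) x) - f x = fwd_diff k f x)"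
    by (rule generically_trivial) (simp add: fwd_diff_def shift_eq_translate)
  ultimately show ?thesis
    unfolding telescoping_def using rational_ratio_refl by blast
qed

section \<open>Lines through a seed\<close>

text \<open>The substitution inside \<open>seed_line\<close>, isolated so that the results on
  surjective polynomial maps apply to it.\<close>

definition seed_point :: "('m \<Rightarrow> int) \<Rightarrow> int \<Rightarrow> ('m wz_var \<Rightarrow> complex) \<Rightarrow> 'm seed_var \<Rightarrow> complex" where
  "seed_point A K x =
     (\<lambda>v. case v of Var_a i \<Rightarrow> x (WZ_a i) + of_int (A i) * x WZ_n
                  | Var_k \<Rightarrow> x WZ_k + of_int K * x WZ_n)"

definition direction :: "('m \<Rightarrow> int) \<Rightarrow> int \<Rightarrow> 'm seed_var \<Rightarrow> complex" where
  "direction A K = (\<lambda>v. case v of Var_a i \<Rightarrow> of_int (A i) | Var_k \<Rightarrow> of_int K)"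

text \<open>The section of \<open>seed_point A K\<close> with \<open>n = c\<close>.\<close>

definition seed_section ::
    "('m \<Rightarrow> int) \<Rightarrow> int \<Rightarrow> complex \<Rightarrow> ('m seed_var \<Rightarrow> complex) \<Rightarrow> 'm wz_var \<Rightarrow> complex" where
  "seed_section A K c y =
     (\<lambda>v. case v of WZ_a i \<Rightarrow> y (Var_a i) - of_int (A i) * c
                  | WZ_n \<Rightarrow> c
                  | WZ_k \<Rightarrow> y Var_k - of_int K * c)"

lemma seed_line_eq: "seed_line f A K x = f (seed_point A K x)"
  by (simp add: seed_line_def seed_point_def)

lemma polynomial_map_seed_point: "polynomial_map (seed_point A K)"
  unfolding polynomial_map_def
proof
  show "polynomial_fun (\<lambda>x. seed_point A K x v)" for v
    by (cases v) (auto simp: seed_point_def intro!: polynomial_fun.intros)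
qed

lemma polynomial_map_seed_section: "polynomial_map (seed_section A K c)"
  unfolding polynomial_map_def
proof
  have "polynomial_fun (\<lambda>y. y u + (- d))" for u :: "'a seed_var" and d
    by (intro polynomial_fun.intros)
  then show "polynomial_fun (\<lambda>y. seed_section A K c y v)" for v
    by (cases v) (auto simp: seed_section_def intro: polynomial_fun.const)
qed

lemma seed_point_section: "seed_point A K (seed_section A K c y) = y"
  by (auto simp: seed_point_def seed_section_def fun_eq_iff split: seed_var.split)

lemma seed_section_point: "seed_section A K (x WZ_n) (seed_point A K x) = x"
  by (auto simp: seed_point_def seed_section_def fun_eq_iff split: wz_var.split)

lemma surj_seed_point: "surj (seed_point A K)"
  by (rule surjI[of _ "seed_section A K 0"]) (rule seed_point_section)

text \<open>Turns the \<open>n\<close>-difference of a seed line into the difference of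
  \<open>f\<close> along \<open>(A, K)\<close>.\<close>

lemma seed_point_shift_n: "seed_point A K (shift WZ_n x) = translate (direction A K) (seed_point A K x)"
  by (auto simp: seed_point_def shift_def translate_def direction_def fun_eq_iff algebra_simps
      split: seed_var.split)

lemma seed_point_shift_k: "seed_point A K (shift WZ_k x) = shift Var_k (seed_point A K x)"
  by (auto simp: seed_point_def shift_def fun_eq_iff split: seed_var.split)

lemma seed_section_shift_k: "seed_section A K c (shift Var_k y) = shift WZ_k (seed_section A K c y)"
  by (auto simp: seed_section_def shift_def fun_eq_iff split: wz_var.split)

text \<open>A nonzero polynomial cannot vanish on every slice of constant \<open>n\<close>: at a
  point \<open>z\<close> where it is nonzero, the slice through \<open>z\<close> has
  \<open>c = z WZ_n\<close>.\<close>

lemma generically_seed_section: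
  assumes "generically P"
  shows "\<exists>c. generically (\<lambda>y. P (seed_section A K c y))"
proof -
  obtain h z where h: "polynomial_fun h" "h z \<noteq> 0" "\<And>x. h x \<noteq> 0 \<Longrightarrow> P x"
    using assms unfolding generically_def by blast
  have "h (seed_section A K (z WZ_n) (seed_point A K z)) \<noteq> 0"
    using h(2) by (simp add: seed_section_point)
  with h(3) polynomial_fun_comp[OF h(1) polynomial_map_seed_section] show ?thesis
    unfolding generically_def by blast
qed

text \<open>Composing the certificate with \<open>seed_point A K\<close> gives the mate, since this
  map carries steps in \<open>n\<close> and \<open>k\<close> to steps along \<open>(A, K)\<close>
  and \<open>Var_k\<close>.\<close>

lemma wz_mate_of_telescoping:
  assumes "telescoping Var_k f (direction A K)"
  shows "\<exists>G. wz_mate (seed_line f A K) G"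
proof -
  obtain G where G: "rational_ratio G f"
    "generically (\<lambda>y. f (translate (direction A K) y) - f y = fwd_diff Var_k G y)"
    using assms unfolding telescoping_def by blast
  note T = polynomial_map_seed_point surj_seed_point
  have "rational_ratio (\<lambda>x. G (seed_point A K x)) (seed_line f A K)"
    unfolding seed_line_eq[abs_def] by (rule rational_ratio_comp[OF G(1) T])
  moreover have "generically (\<lambda>x. fwd_diff WZ_n (seed_line f A K) x
      = fwd_diff WZ_k (\<lambda>x. G (seed_point A K x)) x)"
    by (rule generically_mono[OF generically_comp[OF G(2) T]])
       (simp add: fwd_diff_def seed_line_eq seed_point_shift_n seed_point_shift_k)
  ultimately show ?thesis unfolding wz_mate_def by blast
qed

text \<open>A mate may depend on \<open>n\<close> in its own right, whereas \<open>H\<close> must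
  live on the seed variables. Freezing \<open>n\<close> at a suitable constant removes that
  dependence.\<close>

lemma wz_mate_imp_difference:
  assumes "wz_mate (seed_line f A K) G"
  shows "\<exists>H. rational_ratio H f \<and>
    generically (\<lambda>y. f (translate (direction A K) y) - f y = fwd_diff Var_k H y)"
proof -
  let ?F = "seed_line f A K"
  have diff: "generically (\<lambda>x. fwd_diff WZ_n ?F x = fwd_diff WZ_k G x)"
    and ratio: "rational_ratio G ?F"
    using assms unfolding wz_mate_def by blast+
  obtain p q where pq: "polynomial_fun p" "polynomial_fun q" "\<exists>x. q x \<noteq> 0"
      "generically (\<lambda>x. q x * G x = p x * ?F x)"
    using ratio by (rule rational_ratioE)
  \<comment> \<open>One \<open>c\<close> has to serve all conditions, so they are conjoined before
    slicing. Nonvanishing of \<open>q\<close> is included since a nonzero polynomial may still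
    vanish identically on a particular slice.\<close>
  obtain c where c: "generically (\<lambda>y. (q (seed_section A K c y) \<noteq> 0 \<and>
      q (seed_section A K c y) * G (seed_section A K c y)
        = p (seed_section A K c y) * ?F (seed_section A K c y)) \<and>
      fwd_diff WZ_n ?F (seed_section A K c y) = fwd_diff WZ_k G (seed_section A K c y))"
    using generically_seed_section[OF generically_conj[OF generically_conj[OF
        generically_nonzero[OF pq(2,3)] pq(4)] diff]] by blast
  let ?S = "seed_section A K c"
  have "\<exists>y. q (?S y) \<noteq> 0"
    using generically_imp_ex[OF c] by blast
  then have "rational_ratio (\<lambda>y. G (?S y)) f"
    by (rule rational_ratioI[OF polynomial_fun_comp[OF pq(1) polynomial_map_seed_section[of A K c]]
          polynomial_fun_comp[OF pq(2) polynomial_map_seed_section[of A K c]]])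
       (rule generically_mono[OF c], simp add: seed_line_eq seed_point_section)
  \<comment> \<open>The shift in \<open>n\<close> leaves the slice, but affects only
    \<open>F\<close>, which factors through \<open>seed_point\<close>; the shift in
    \<open>k\<close>, applied to \<open>G\<close>, stays inside it.\<close>
  moreover have "generically (\<lambda>y. f (translate (direction A K) y) - f y
      = fwd_diff Var_k (\<lambda>y. G (?S y)) y)"
    by (rule generically_mono[OF c])
       (simp add: fwd_diff_def seed_line_eq seed_point_shift_n seed_point_section seed_section_shift_k)
  ultimately show ?thesis by blast
qed

section \<open>Integer directions from unit vectors, and the equivalence\<close>

lemma direction_eq_sum:
  fixes A :: "'m::finite \<Rightarrow> int"
  shows "direction A K =
    (\<lambda>u. (\<Sum>i\<in>UNIV. of_int (A i) * unit_vec (Var_a i) u) + of_int K * unit_vec Var_k u)"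
proof
  fix u
  show "direction A K u =
    (\<Sum>i\<in>UNIV. of_int (A i) * unit_vec (Var_a i) u) + of_int K * unit_vec Var_k u"
  proof (cases u)
    case (Var_a j)
    have "(\<Sum>i\<in>UNIV. of_int (A i) * unit_vec (Var_a i) u)
        = (\<Sum>i\<in>UNIV. if j = i then complex_of_int (A i) else 0)"
      by (rule sum.cong) (auto simp: Var_a unit_vec_def)
    then show ?thesis by (simp add: Var_a direction_def unit_vec_def)
  qed (simp add: direction_def unit_vec_def)
qed

lemma direction_unit: "direction (\<lambda>j. if j = i then 1 else 0) 0 = unit_vec (Var_a i)"
  by (auto simp: direction_def unit_vec_def fun_eq_iff split: seed_var.split)

theorem theorem3p1:
  fixes f :: "('m::finite seed_var \<Rightarrow> complex) \<Rightarrow> complex"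
  assumes "hypergeometric_term f"
  shows "wz_seed f \<longleftrightarrow>
    (\<forall>i. \<exists>r. rational_fun r \<and>
       generically (\<lambda>x. fwd_diff (Var_a i) f x = fwd_diff Var_k (\<lambda>y. r y * f y) x))"
  unfolding rational_multiple_iff_rational_ratio
proof
  assume seed: "wz_seed f"
  show "\<forall>i. \<exists>G. rational_ratio G f \<and> generically (\<lambda>x. fwd_diff (Var_a i) f x = fwd_diff Var_k G x)"
  proof
    fix i
    \<comment> \<open>With this \<open>A\<close> and \<open>K = 0\<close>, one step in
      \<open>n\<close> is one step in the variable \<open>Var_a i\<close>.\<close>
    obtain G where "wz_mate (seed_line f (\<lambda>j. if j = i then 1 else 0) 0) G"
      using seed unfolding wz_seed_def by blast
    from wz_mate_imp_difference[OF this]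
    show "\<exists>G. rational_ratio G f \<and> generically (\<lambda>x. fwd_diff (Var_a i) f x = fwd_diff Var_k G x)"
      by (simp add: direction_unit fwd_diff_def[of "Var_a i"] shift_eq_translate[of "Var_a i"])
  qed
next
  assume diff: "\<forall>i. \<exists>G. rational_ratio G f \<and>
    generically (\<lambda>x. fwd_diff (Var_a i) f x = fwd_diff Var_k G x)"
  \<comment> \<open>Condition (2) provides the certificate, and \<open>f\<close> being
    hypergeometric provides the ratio clause.\<close>
  have "telescoping Var_k f (unit_vec (Var_a i))" for i
    using diff[rule_format, of i] assms
    by (simp add: telescoping_def hypergeometric_term_def
        fwd_diff_def[of "Var_a i"] shift_eq_translate[abs_def])
  \<comment> \<open>Unit vectors generate all integer directions under the group operations; the one
    for \<open>k\<close> is good by \<open>telescoping_self\<close>.\<close>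
  then have "telescoping Var_k f (direction A K)" for A K
    unfolding direction_eq_sum
    by (intro telescoping_add telescoping_sum telescoping_int_mult telescoping_self[OF assms]) auto
  then show "wz_seed f"
    unfolding wz_seed_def using wz_mate_of_telescoping by blast
qed

end
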